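(* For any $n\geq2$ and $w\in\{+,-\}^n$, we have \begin{align*} R^{(1)}_{w+}&=\Phi_{4,1,2}(R^{(1)}_w)+\Phi_{3,1,2}(R^{(2)}_w)+\Phi_{2,2,1}(R^{(4)}_w),\\ R^{(2)}_{w+}&=\Phi_{3,4,2}(R^{(3)}_w)+\Phi_{2,2,4}(R^{(5)}_w),\\ R^{(3)}_{w+}&=\Phi_{3,4,1}(R^{(3)}_w)+\Phi_{2,4,1}(R^{(5)}_w)+\Phi_{1,1,4}(R^{(6)}_w),\\ R^{(4)}_{w+}&=\Phi_{1,1,4}(R^{(1)}_w),\\ R^{(5)}_{w+}&=\Phi_{4,1,3}(R^{(1)}_w)+\Phi_{1,1,3}(R^{(2)}_w),\\ R^{(6)}_{w+}&=\Phi_{4,4,3}(R^{(3)}_w),\\ R^{(1)}_{w-}&=\Phi_{1,1,2}(R^{(4)}_w),\\ R^{(2)}_{w-}&=\Phi_{1,4,2}(R^{(6)}_w)+\Phi_{4,4,2}(R^{(5)}_w),\\ R^{(3)}_{w-}&=\Phi_{4,4,1}(R^{(6)}_w),\\ R^{(4)}_{w-}&=\Phi_{2,1,4}(R^{(4)}_w)+\Phi_{3,1,4}(R^{(2)}_w)+\Phi_{4,4,1}(R^{(1)}_w),\\ R^{(5)}_{w-}&=\Phi_{2,1,3}(R^{(4)}_w)+\Phi_{3,3,1}(R^{(2)}_w),\\ R^{(6)}_{w-}&=\Phi_{1,4,3}(R^{(6)}_w)+\Phi_{2,4,3}(R^{(5)}_w)+\Phi_{3,3,4}(R^{(3)}_w).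 \end{align*}
   Context: A total cyclic order on a finite set $X$ is a set $Z$ of triples of distinct elements of $X$ such that: $(x,y,z)\in Z\Rightarrow (y,z,x)\in Z$; $(x,y,z)\in Z\Rightarrow (z,y,x)\notin Z$; $(x,y,z)\in Z$ and $(x,z,u)\in Z\Rightarrow (x,y,u)\in Z$; and for any three distinct $x,y,z$, either $(x,y,z)\in Z$ or $(z,y,x)\in Z$. For $w=\epsilon_1\cdots\epsilon_{m-2}\in\{+,-\}^{m-2}$ ($m\geq 4$), $\mathcal{P}_w$ is the set of total cyclic orders $Z$ on $[m]$ such that for every $1\leq i\leq m-2$, $(i,i+1,i+2)\in Z$ if $\epsilon_i=+$ and $(i+2,i+1,i)\in Z$ if $\epsilon_i=-$. A tuple $(y_1,\dots,y_p)$ of distinct elements ($p\geq3$) is a $Z$-chain if $(y_1,y_{i-1},y_i)\in Z$ for all $3\leq i\leq p$. Define $\mathcal{R}^{(1)}_w,\dots,\mathcal{R}^{(6)}_w$ as the sets of $Z\in\mathcal{P}_w$ such that, respectively, $(1,2,m-1,m)$, $(1,m-1,2,m)$, $(1,m-1,m,2)$, $(1,2,m,m-1)$, $(1,m,2,m-1)$, $(1,m,m-1,2)$ is a $Z$-chain. Let $c_Z(a,b)=\#\{x:(a,x,b)\in Z\}$ and $\tilde c_Z(y_1,\dots,y_p)=(c_Z(y_1,y_2),\dots,c_Z(y_{p-1},y_p),c_Z(y_p,y_1))$. For nonnegative $i,j,k,\ell$ with $i+j+k+\ell=m-4$ define $g^{(1)}_{w,i,j,k,\ell}=\#\{Z\in\mathcal{R}^{(1)}_w:\tilde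 c_Z(m-1,m,1,2)=(i,j,k,\ell)\}$, $g^{(2)}_{w,i,j,k,\ell}=\#\{Z\in\mathcal{R}^{(2)}_w:\tilde c_Z(m-1,2,m,1)=(i,\ell,j,k)\}$, $g^{(3)}_{w,i,j,k,\ell}=\#\{Z\in\mathcal{R}^{(3)}_w:\tilde c_Z(m,2,1,m-1)=(i,j,k,\ell)\}$, $g^{(4)}_{w,i,j,k,\ell}=\#\{Z\in\mathcal{R}^{(4)}_w:\tilde c_Z(m,m-1,1,2)=(i,j,k,\ell)\}$, $g^{(5)}_{w,i,j,k,\ell}=\#\{Z\in\mathcal{R}^{(5)}_w:\tilde c_Z(m,2,m-1,1)=(i,\ell,j,k)\}$, $g^{(6)}_{w,i,j,k,\ell}=\#\{Z\in\mathcal{R}^{(6)}_w:\tilde c_Z(m-1,2,1,m)=(i,j,k,\ell)\}$. For $w\in\{+,-\}^n$ ($n\geq 2$) and $1\leq\alpha\leq6$, $R^{(\alpha)}_w(X_1,X_2,X_3,X_4)=\sum_{i+j+k+\ell=n-2} g^{(\alpha)}_{w,i,j,k,\ell}X_1^iX_2^jX_3^kX_4^\ell$. The words $w+$, $w-$ are $w$ with $+$, resp. $-$, appended. For $1\leq a,b,c\leq 4$ with $b\neq c$, $\Phi_{a,b,c}$ is the linear endomorphism of $\mathbb{Z}[X_1,\dots,X_4]$ defined on monomials by $\Phi_{a,b,c}\left(\prod_{\ell} X_\ell^{i_\ell}\right)=\left(\prod_{\ell\notin\{b,c\}}X_\ell^{i_\ell}\right)X_a^{i_b+1}\sum_{k=0}^{i_c}X_b^{i_c-k}X_c^{k}$.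 *)

theory Defs
  imports "HOL-Library.Poly_Mapping" "HOL-Library.Numeral_Type"
begin

definition total_cyclic_order :: "'a set \<Rightarrow> ('a \<times> 'a \<times> 'a) set \<Rightarrow> bool" where
  "total_cyclic_order X Z \<longleftrightarrow>
     (\<forall>x y z. (x, y, z) \<in> Z \<longrightarrow> x \<in> X \<and> y \<in> X \<and> z \<in> X \<and> x \<noteq> y \<and> y \<noteq> z \<and> x \<noteq> z) \<and>
     (\<forall>x y z. (x, y, z) \<in> Z \<longrightarrow> (y, z, x) \<in> Z) \<and>
     (\<forall>x y z. (x, y, z) \<in> Z \<longrightarrow> (z, y, x) \<notin> Z) \<and>
     (\<forall>x y z u. (x, y, z) \<in> Z \<and> (x, z, u) \<in> Z \<longrightarrow> (x, y, u) \<in> Z) \<and>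
     (\<forall>x\<in>X. \<forall>y\<in>X. \<forall>z\<in>X. x \<noteq> y \<and> y \<noteq> z \<and> x \<noteq> z \<longrightarrow> (x, y, z) \<in> Z \<or> (z, y, x) \<in> Z)"

datatype sign = Plus | Minus

text \<open>
  A word of length \<open>m - 2\<close> gives orders on \<open>{1..m}\<close>; letters are counted from 1 on paper,
  whereas \<open>!\<close> counts from 0.
\<close>

definition orders_of_word :: "sign list \<Rightarrow> (nat \<times> nat \<times> nat) set set" where
  "orders_of_word w =
     {Z. total_cyclic_order {1..length w + 2} Z \<and>
         (\<forall>i\<in>{1..length w}.
            case w ! (i - 1) of
              Plus \<Rightarrow> (i, i + 1, i + 2) \<in> Z
            | Minus \<Rightarrow> (i + 2, i + 1, i) \<in> Z)}"

definition is_chain :: "('a \<times> 'a \<times> 'a) set \<Rightarrow> 'a list \<Rightarrow> bool" where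
  "is_chain Z ys \<longleftrightarrow> distinct ys \<and> length ys \<ge> 3 \<and>
     (\<forall>i\<in>{3..length ys}. (ys ! 0, ys ! (i - 2), ys ! (i - 1)) \<in> Z)"

definition between_count :: "('a \<times> 'a \<times> 'a) set \<Rightarrow> 'a \<Rightarrow> 'a \<Rightarrow> nat" where
  "between_count Z a b = card {x. (a, x, b) \<in> Z}"

text \<open>The list \<open>[c(y\<^sub>1, y\<^sub>2), \<dots>, c(y\<^sub>p\<^sub>-\<^sub>1, y\<^sub>p), c(y\<^sub>p, y\<^sub>1)]\<close>.\<close>

definition gap_counts :: "('a \<times> 'a \<times> 'a) set \<Rightarrow> 'a list \<Rightarrow> nat list" where
  "gap_counts Z ys = map2 (between_count Z) ys (rotate1 ys)"

definition chain_orders :: "sign list \<Rightarrow> nat list \<Rightarrow> (nat \<times> nat \<times> nat) set set" where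
  "chain_orders w ys = {Z \<in> orders_of_word w. is_chain Z ys}"

definition RR1 :: "sign list \<Rightarrow> (nat \<times> nat \<times> nat) set set" where
  "RR1 w = (let m = length w + 2 in chain_orders w [1, 2, m - 1, m])"

definition RR2 :: "sign list \<Rightarrow> (nat \<times> nat \<times> nat) set set" where
  "RR2 w = (let m = length w + 2 in chain_orders w [1, m - 1, 2, m])"

definition RR3 :: "sign list \<Rightarrow> (nat \<times> nat \<times> nat) set set" where
  "RR3 w = (let m = length w + 2 in chain_orders w [1, m - 1, m, 2])"

definition RR4 :: "sign list \<Rightarrow> (nat \<times> nat \<times> nat) set set" where
  "RR4 w = (let m = length w + 2 in chain_orders w [1, 2, m, m - 1])"

definition RR5 :: "sign list \<Rightarrow> (nat \<times> nat \<times> nat) set set" where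
  "RR5 w = (let m = length w + 2 in chain_orders w [1, m, 2, m - 1])"

definition RR6 :: "sign list \<Rightarrow> (nat \<times> nat \<times> nat) set set" where
  "RR6 w = (let m = length w + 2 in chain_orders w [1, m, m - 1, 2])"

text \<open>Note the permuted right-hand sides \<open>[i, l, j, k]\<close> for the second and fifth families.\<close>

definition g1 :: "sign list \<Rightarrow> nat \<Rightarrow> nat \<Rightarrow> nat \<Rightarrow> nat \<Rightarrow> nat" where
  "g1 w i j k l = (let m = length w + 2 in
     card {Z \<in> RR1 w. gap_counts Z [m - 1, m, 1, 2] = [i, j, k, l]})"

definition g2 :: "sign list \<Rightarrow> nat \<Rightarrow> nat \<Rightarrow> nat \<Rightarrow> nat \<Rightarrow> nat" where
  "g2 w i j k l = (let m = length w + 2 in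
     card {Z \<in> RR2 w. gap_counts Z [m - 1, 2, m, 1] = [i, l, j, k]})"

definition g3 :: "sign list \<Rightarrow> nat \<Rightarrow> nat \<Rightarrow> nat \<Rightarrow> nat \<Rightarrow> nat" where
  "g3 w i j k l = (let m = length w + 2 in
     card {Z \<in> RR3 w. gap_counts Z [m, 2, 1, m - 1] = [i, j, k, l]})"

definition g4 :: "sign list \<Rightarrow> nat \<Rightarrow> nat \<Rightarrow> nat \<Rightarrow> nat \<Rightarrow> nat" where
  "g4 w i j k l = (let m = length w + 2 in
     card {Z \<in> RR4 w. gap_counts Z [m, m - 1, 1, 2] = [i, j, k, l]})"

definition g5 :: "sign list \<Rightarrow> nat \<Rightarrow> nat \<Rightarrow> nat \<Rightarrow> nat \<Rightarrow> nat" where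
  "g5 w i j k l = (let m = length w + 2 in
     card {Z \<in> RR5 w. gap_counts Z [m, 2, m - 1, 1] = [i, l, j, k]})"

definition g6 :: "sign list \<Rightarrow> nat \<Rightarrow> nat \<Rightarrow> nat \<Rightarrow> nat \<Rightarrow> nat" where
  "g6 w i j k l = (let m = length w + 2 in
     card {Z \<in> RR6 w. gap_counts Z [m - 1, 2, 1, m] = [i, j, k, l]})"

text \<open>
  The polynomial ring over the integers in the variables \<open>X\<^sub>1, \<dots>, X\<^sub>4\<close>, as the monoid ring of
  the exponent vectors. Variables are indexed by the four-element type \<open>4\<close>, whose elements are
  \<open>1\<close>, \<open>2\<close>, \<open>3\<close> and \<open>4\<close> (the last one being equal to \<open>0\<close>).
\<close>

type_synonym expo = "4 \<Rightarrow>\<^sub>0 nat"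
type_synonym poly4 = "expo \<Rightarrow>\<^sub>0 int"

definition X :: "4 \<Rightarrow> poly4" where
  "X a = Poly_Mapping.single (Poly_Mapping.single a 1) 1"

definition gen_poly :: "nat \<Rightarrow> (nat \<Rightarrow> nat \<Rightarrow> nat \<Rightarrow> nat \<Rightarrow> nat) \<Rightarrow> poly4" where
  "gen_poly n g = (\<Sum>(i, j, k, l) \<in> {(i, j, k, l). i + j + k + l = n - 2}.
     of_nat (g i j k l) * X 1 ^ i * X 2 ^ j * X 3 ^ k * X 4 ^ l)"

definition R1 :: "sign list \<Rightarrow> poly4" where "R1 w = gen_poly (length w) (g1 w)"
definition R2 :: "sign list \<Rightarrow> poly4" where "R2 w = gen_poly (length w) (g2 w)"
definition R3 :: "sign list \<Rightarrow> poly4" where "R3 w = gen_poly (length w) (g3 w)"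
definition R4 :: "sign list \<Rightarrow> poly4" where "R4 w = gen_poly (length w) (g4 w)"
definition R5 :: "sign list \<Rightarrow> poly4" where "R5 w = gen_poly (length w) (g5 w)"
definition R6 :: "sign list \<Rightarrow> poly4" where "R6 w = gen_poly (length w) (g6 w)"

text \<open>
  \<open>frag_extend\<close> is the extension by integer linearity of a function given on the basis of
  monomials. Only arguments with \<open>b \<noteq> c\<close> are meaningful.
\<close>

definition Phi :: "4 \<Rightarrow> 4 \<Rightarrow> 4 \<Rightarrow> poly4 \<Rightarrow> poly4" where
  "Phi a b c = frag_extend (\<lambda>e.
     (\<Prod>v\<in>UNIV - {b, c}. X v ^ Poly_Mapping.lookup e v) * X a ^ (Poly_Mapping.lookup e b + 1) *
     (\<Sum>k = 0..Poly_Mapping.lookup e c. X b ^ (Poly_Mapping.lookup e c - k) * X c ^ k))"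

end

theory Submission
  imports Defs
begin

text \<open>
  Cutting a total cyclic order on \<open>{1..m}\<close> open at \<open>1\<close> turns it into a position function
  \<open>p\<close>, a bijection from \<open>{1..m}\<close> onto \<open>{..<m}\<close> with \<open>p 1 = 0\<close>. The region of an order and all its
  gap counts depend only on \<open>p 2\<close>, \<open>p (m - 1)\<close> and \<open>p m\<close>, and an order on \<open>{1..m+1}\<close> arises from
  a unique order on \<open>{1..m}\<close> by inserting \<open>m + 1\<close> at some position \<open>d \<in> {1..m}\<close>. So the
  theorem reduces to one identity for each of the six relative orders of \<open>p 2\<close>, \<open>p (m - 1)\<close>,
  \<open>p m\<close>: inserting \<open>m + 1\<close> splits the gap \<open>c\<close> in two, and forgetting \<open>m - 1\<close> merges its
  two neighbouring gaps, which is what \<open>Phi a b c\<close> does to the gap monomial.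
\<close>

subsection \<open>Position functions of total cyclic orders\<close>

definition cyc :: "nat \<Rightarrow> nat \<Rightarrow> nat \<Rightarrow> bool" where
  "cyc x y z \<longleftrightarrow> x < y \<and> y < z \<or> y < z \<and> z < x \<or> z < x \<and> x < y"

text \<open>The value 0 at 1 picks one of the \<open>m\<close> rotations of the cyclic order. The
  value 0 outside \<open>{1..m}\<close> makes the function determined by the order it induces.
  Surjectivity onto \<open>{..<m}\<close> follows from injectivity by counting.\<close>

definition positions :: "nat \<Rightarrow> (nat \<Rightarrow> nat) set" where
  "positions m = {p. inj_on p {1..m} \<and> (\<forall>x\<in>{1..m}. p x < m) \<and> p 1 = 0 \<and> (\<forall>x. x \<notin> {1..m} \<longrightarrow> p x = 0)}"

definition order_of_positions :: "nat \<Rightarrow> (nat \<Rightarrow> nat) \<Rightarrow> (nat \<times> nat \<times> nat) set" where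
  "order_of_positions m p = {(x, y, z). x \<in> {1..m} \<and> y \<in> {1..m} \<and> z \<in> {1..m} \<and> cyc (p x) (p y) (p z)}"

lemma positions_bij_betw:
  assumes "p \<in> positions m"
  shows "bij_betw p {1..m} {..<m}"
proof -
  have "p ` {1..m} \<subseteq> {..<m}" "inj_on p {1..m}" using assms by (auto simp: positions_def)
  moreover from this have "p ` {1..m} = {..<m}" by (intro card_subset_eq) (auto simp: card_image)
  ultimately show ?thesis by (simp add: bij_betw_def)
qed

lemma finite_positions: "finite (positions m)"
proof (rule finite_subset)
  show "positions m \<subseteq> {p. \<forall>x. (x \<in> {1..m} \<longrightarrow> p x \<in> {..<m}) \<and> (x \<notin> {1..m} \<longrightarrow> p x = 0)}"
    by (auto simp: positions_def)
  show "finite {p. \<forall>x. (x \<in> {1..m} \<longrightarrow> p x \<in> {..<m}) \<and> (x \<notin> {1..m} \<longrightarrow> p x = (0::nat))}"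
    by (rule finite_set_of_finite_funs) auto
qed

lemma total_cyclic_order_order_of_positions:
  assumes "p \<in> positions m"
  shows "total_cyclic_order {1..m} (order_of_positions m p)"
proof -
  have "cyc (p x) (p y) (p z) \<or> cyc (p z) (p y) (p x)"
    if "x \<in> {1..m}" "y \<in> {1..m}" "z \<in> {1..m}" "x \<noteq> y" "y \<noteq> z" "x \<noteq> z" for x y z
  proof -
    have "inj_on p {1..m}" using assms by (simp add: positions_def)
    then have "p x \<noteq> p y" "p y \<noteq> p z" "p x \<noteq> p z"
      using that by (auto dest: inj_onD)
    then show ?thesis unfolding cyc_def by linarith
  qed
  then show ?thesis
    unfolding total_cyclic_order_def order_of_positions_def
    by (auto simp: cyc_def)
qed

lemma card_between_positions:
  assumes "p \<in> positions m" "x \<in> {1..m}" "z \<in> {1..m}"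
  shows "card {y. (x, y, z) \<in> order_of_positions m p} = card {u. u < m \<and> cyc (p x) u (p z)}"
proof -
  note bij = positions_bij_betw[OF assms(1)]
  have "{y. (x, y, z) \<in> order_of_positions m p} = {y \<in> {1..m}. cyc (p x) (p y) (p z)}"
    using assms(2,3) by (auto simp: order_of_positions_def)
  then have "p ` {y. (x, y, z) \<in> order_of_positions m p} = {u \<in> p ` {1..m}. cyc (p x) u (p z)}"
    by blast
  also have "\<dots> = {u. u < m \<and> cyc (p x) u (p z)}"
    by (simp only: bij_betw_imp_surj_on[OF bij] lessThan_iff)
  finally have "p ` {y. (x, y, z) \<in> order_of_positions m p} = {u. u < m \<and> cyc (p x) u (p z)}" .
  moreover have "inj_on p {y. (x, y, z) \<in> order_of_positions m p}"
    by (rule inj_on_subset[OF bij_betw_imp_inj_on[OF bij]]) (auto simp: order_of_positions_def)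
  ultimately show ?thesis using card_image[of p "{y. (x, y, z) \<in> order_of_positions m p}"] by simp
qed

text \<open>The elements in between are those met on the way up from \<open>p x\<close> to
  \<open>p z\<close>, passing the end of the range when \<open>p x > p z\<close>. For
  \<open>x = z\<close> truncated subtraction gives the correct count 0.\<close>

lemma between_count_order_of_positions:
  assumes "p \<in> positions m" "x \<in> {1..m}" "z \<in> {1..m}"
  shows "between_count (order_of_positions m p) x z =
    (if p x \<le> p z then p z - p x - 1 else m - p x - 1 + p z)"
proof -
  have lt: "p x < m" "p z < m" using assms by (auto simp: positions_def)
  have "card {u. u < m \<and> cyc (p x) u (p z)} = (if p x \<le> p z then p z - p x - 1 else m - p x - 1 + p z)"
  proof (cases "p x \<le> p z")
    case True
    then have "{u. u < m \<and> cyc (p x) u (p z)} = {p x<..<p z}"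
      using lt by (auto simp: cyc_def)
    then show ?thesis using True by simp
  next
    case False
    then have "{u. u < m \<and> cyc (p x) u (p z)} = {p x<..<m} \<union> {..<p z}"
      using lt by (auto simp: cyc_def)
    moreover have "card ({p x<..<m} \<union> {..<p z}) = card {p x<..<m} + card {..<p z}"
      using False by (intro card_Un_disjoint) auto
    ultimately show ?thesis using False by simp
  qed
  then show ?thesis using card_between_positions[OF assms] by (simp add: between_count_def)
qed

text \<open>In the linear order obtained by cutting at 1, an element \<open>x\<close> other than 1
  is preceded by 1 itself, which \<open>Suc\<close> accounts for, and by every \<open>y\<close> with
  \<open>(1, y, x)\<close> in \<open>Z\<close>.\<close>

definition position :: "(nat \<times> nat \<times> nat) set \<Rightarrow> nat \<Rightarrow> nat \<Rightarrow> nat" where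
  "position Z m x = (if x \<in> {2..m} then Suc (card {y. (1, y, x) \<in> Z}) else 0)"

lemma position_order_of_positions:
  assumes "p \<in> positions m" "m \<ge> 1"
  shows "position (order_of_positions m p) m = p"
proof
  fix x
  have p1: "p 1 = 0" using assms by (simp add: positions_def)
  show "position (order_of_positions m p) m x = p x"
  proof (cases "x \<in> {2..m}")
    case True
    then have "p x \<noteq> 0" using assms p1 inj_onD[of p "{1..m}" x 1] by (auto simp: positions_def)
    then show ?thesis
      using True between_count_order_of_positions[OF assms(1), of 1 x] assms(2) p1
      by (auto simp: position_def between_count_def)
  next
    case False
    then have "x = 1 \<or> x \<notin> {1..m}" by auto
    then have "p x = 0" using p1 assms by (auto simp: positions_def)
    then show ?thesis using False by (simp add: position_def)
  qed
qed

text \<open>The triples of \<open>Z\<close> that start with 1 form a strict linear order on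
  \<open>{2..m}\<close>, and counting predecessors is strictly monotone for it. These triples
  determine all others by rotation and transitivity. Hence the triples induced by the positions lie
  in \<open>Z\<close>, and by totality and asymmetry there are no further ones.\<close>

lemma
  assumes Z: "total_cyclic_order {1..m} Z" and "m \<ge> 1"
  shows position_in_positions: "position Z m \<in> positions m"
    and order_of_position: "order_of_positions m (position Z m) = Z"
proof -
  let ?p = "position Z m"
  note ax = Z[unfolded total_cyclic_order_def]
  note axA = conjunct1[OF ax]
  note axB = conjunct1[OF conjunct2[OF ax]]
  note axC = conjunct1[OF conjunct2[OF conjunct2[OF ax]]]
  note axD = conjunct1[OF conjunct2[OF conjunct2[OF conjunct2[OF ax]]]]
  note axE = conjunct2[OF conjunct2[OF conjunct2[OF conjunct2[OF ax]]]]
  have dom: "x \<in> {1..m} \<and> y \<in> {1..m} \<and> z \<in> {1..m} \<and> x \<noteq> y \<and> y \<noteq> z \<and> x \<noteq> z" if "(x, y, z) \<in> Z" for x y z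
    using axA that by blast
  have rot: "(y, z, x) \<in> Z" if "(x, y, z) \<in> Z" for x y z
    using axB that by blast
  have asym: "(z, y, x) \<notin> Z" if "(x, y, z) \<in> Z" for x y z
    using axC that by blast
  have tr: "(x, y, u) \<in> Z" if "(x, y, z) \<in> Z" "(x, z, u) \<in> Z" for x y z u
    using axD that by blast
  have tot: "(x, y, z) \<in> Z \<or> (z, y, x) \<in> Z"
    if "x \<in> {1..m}" "y \<in> {1..m}" "z \<in> {1..m}" "x \<noteq> y" "y \<noteq> z" "x \<noteq> z" for x y z
    using axE that by blast
  have p1: "?p 1 = 0" by (simp add: position_def)
  have sub: "{y. (1, y, x) \<in> Z} \<subseteq> {2..m} - {x}" for x
  proof
    fix y assume "y \<in> {y. (1, y, x) \<in> Z}"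
    then have "(1, y, x) \<in> Z" by simp
    from dom[OF this] show "y \<in> {2..m} - {x}" by auto
  qed
  then have fin: "finite {y. (1, y, x) \<in> Z}" for x using finite_subset by blast
  \<comment> \<open>The predecessors of \<open>x\<close> are predecessors of \<open>y\<close> by
    transitivity, and \<open>x\<close> itself is an additional one.\<close>
  have mono: "?p x < ?p y" if "(1, x, y) \<in> Z" for x y
  proof -
    have "x \<in> {2..m}" "y \<in> {2..m}" using dom[OF that] by auto
    moreover have "{u. (1, u, x) \<in> Z} \<subset> {u. (1, u, y) \<in> Z}"
    proof (rule psubsetI)
      show "{u. (1, u, x) \<in> Z} \<subseteq> {u. (1, u, y) \<in> Z}" using tr[OF _ that] by auto
      have "x \<in> {u. (1, u, y) \<in> Z}" "x \<notin> {u. (1, u, x) \<in> Z}" using that dom[of 1 x x] by auto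
      then show "{u. (1, u, x) \<in> Z} \<noteq> {u. (1, u, y) \<in> Z}" by metis
    qed
    ultimately show ?thesis using psubset_card_mono[OF fin] by (simp add: position_def)
  qed
  have lin: "(1, x, y) \<in> Z \<or> (1, y, x) \<in> Z" if "x \<in> {2..m}" "y \<in> {2..m}" "x \<noteq> y" for x y
    using tot[of 1 x y] that rot[of y x 1] rot[of x 1 y] by auto
  have pos: "?p x > 0" if "x \<in> {2..m}" for x using that by (simp add: position_def)
  have less: "x = 1 \<and> y \<noteq> 1 \<or> (1, x, y) \<in> Z" if "x \<in> {1..m}" "y \<in> {1..m}" "?p x < ?p y" for x y
  proof (cases "x = 1 \<or> y = 1")
    case True
    then show ?thesis using that p1 by auto
  next
    case False
    then have "x \<in> {2..m}" "y \<in> {2..m}" "x \<noteq> y" using that by auto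
    then show ?thesis using lin[of x y] mono[of y x] that(3) by auto
  qed
  have "?p x \<noteq> ?p y" if "x \<in> {1..m}" "y \<in> {1..m}" "x \<noteq> y" for x y
  proof (cases "x = 1 \<or> y = 1")
    case True
    then show ?thesis using that p1 pos[of x] pos[of y] by auto
  next
    case False
    then have "x \<in> {2..m}" "y \<in> {2..m}" using that by auto
    then show ?thesis using lin[of x y] mono[of y x] mono[of x y] that(3) by auto
  qed
  then have inj: "inj_on ?p {1..m}" unfolding inj_on_def by blast
  have "?p x < m" if "x \<in> {1..m}" for x
  proof (cases "x = 1")
    case False
    then have x: "x \<in> {2..m}" using that by auto
    have "card {y. (1, y, x) \<in> Z} \<le> card ({2..m} - {x})"
      by (rule card_mono[OF _ sub]) simp
    also have "\<dots> = m - 2" using x by simp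
    finally show ?thesis using x by (auto simp: position_def)
  qed (use assms p1 in simp)
  then show "position Z m \<in> positions m"
    using inj p1 by (auto simp: positions_def position_def)
  have step: "(x, y, z) \<in> Z" if "x \<in> {1..m}" "y \<in> {1..m}" "z \<in> {1..m}" "?p x < ?p y" "?p y < ?p z" for x y z
  proof (cases "x = 1")
    case True
    then show ?thesis using less[of y z] that p1 by auto
  next
    case False
    then have "(1, x, y) \<in> Z" "(1, y, z) \<in> Z" using less[of x y] less[of y z] that p1 by auto
    \<comment> \<open>Transitivity based at \<open>y\<close>: \<open>(y, z, 1)\<close> and
      \<open>(y, 1, x)\<close> are rotations of the two triples through 1.\<close>
    then have "(y, z, x) \<in> Z" using tr[of y z 1 x] rot[of 1 y z] rot[of x y 1] rot[of 1 x y] by auto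
    then show ?thesis by (rule rot[OF rot])
  qed
  have cyc_imp: "(x, y, z) \<in> Z" if "x \<in> {1..m}" "y \<in> {1..m}" "z \<in> {1..m}" "cyc (?p x) (?p y) (?p z)" for x y z
    using that(4)[unfolded cyc_def] step[OF that(1-3)] rot[OF rot[OF step[OF that(2,3,1)]]]
      rot[OF step[OF that(3,1,2)]] by argo
  have imp_cyc: "cyc (?p x) (?p y) (?p z)" if "(x, y, z) \<in> Z" for x y z
  proof (rule ccontr)
    assume not: "\<not> cyc (?p x) (?p y) (?p z)"
    have d: "x \<in> {1..m}" "y \<in> {1..m}" "z \<in> {1..m}" "x \<noteq> y" "y \<noteq> z" "x \<noteq> z" using dom[OF that] by auto
    then have "?p x \<noteq> ?p y" "?p y \<noteq> ?p z" "?p x \<noteq> ?p z" using inj by (auto dest: inj_onD)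
    then have "cyc (?p z) (?p y) (?p x)" using not unfolding cyc_def by linarith
    then show False using cyc_imp d asym[OF that] by blast
  qed
  show "order_of_positions m ?p = Z"
  proof (intro set_eqI iffI)
    fix t assume t: "t \<in> order_of_positions m ?p"
    obtain x y z where "t = (x, y, z)" by (cases t)
    with t show "t \<in> Z" using cyc_imp[of x y z] by (simp add: order_of_positions_def)
  next
    fix t assume t: "t \<in> Z"
    obtain x y z where "t = (x, y, z)" by (cases t)
    with t show "t \<in> order_of_positions m ?p"
      using imp_cyc[of x y z] dom[of x y z] by (simp add: order_of_positions_def)
  qed
qed

section \<open>Position functions of the orders belonging to a word\<close>

fun holds_sign :: "sign \<Rightarrow> nat \<Rightarrow> nat \<Rightarrow> nat \<Rightarrow> bool" where
  "holds_sign Plus x y z \<longleftrightarrow> cyc x y z"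
| "holds_sign Minus x y z \<longleftrightarrow> cyc z y x"

definition word_positions :: "sign list \<Rightarrow> (nat \<Rightarrow> nat) set" where
  "word_positions w = {p \<in> positions (length w + 2).
     \<forall>i<length w. holds_sign (w ! i) (p (i + 1)) (p (i + 2)) (p (i + 3))}"

lemma finite_word_positions: "finite (word_positions w)"
  using finite_positions by (simp add: word_positions_def)

lemma order_of_positions_in_orders_of_word_iff:
  assumes "p \<in> positions (length w + 2)"
  shows "order_of_positions (length w + 2) p \<in> orders_of_word w \<longleftrightarrow> p \<in> word_positions w"
proof -
  let ?Z = "order_of_positions (length w + 2) p"
  \<comment> \<open>Letters are counted from 1 in \<open>orders_of_word\<close> but from 0 in
    \<open>word_positions\<close>.\<close>
  have shift: "(\<forall>i\<in>{1..length w}. Q i) \<longleftrightarrow> (\<forall>i<length w. Q (i + 1))" for Q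
    by (auto simp: Ball_def) (metis Suc_pred Suc_le_eq)
  have "(case w ! i of Plus \<Rightarrow> (i + 1, i + 1 + 1, i + 1 + 2) \<in> ?Z | Minus \<Rightarrow> (i + 1 + 2, i + 1 + 1, i + 1) \<in> ?Z)
      \<longleftrightarrow> holds_sign (w ! i) (p (i + 1)) (p (i + 2)) (p (i + 3))" if "i < length w" for i
    using that by (cases "w ! i") (simp_all add: order_of_positions_def numeral_3_eq_3)
  then show ?thesis
    using assms total_cyclic_order_order_of_positions[OF assms]
    by (simp add: orders_of_word_def word_positions_def shift del: add_2_eq_Suc' One_nat_def)
qed

lemma bij_betw_order_of_positions:
  "bij_betw (order_of_positions (length w + 2)) (word_positions w) (orders_of_word w)"
proof (rule bij_betw_byWitness[where f' = "\<lambda>Z. position Z (length w + 2)"])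
  show "\<forall>p\<in>word_positions w. position (order_of_positions (length w + 2) p) (length w + 2) = p"
    by (auto simp: word_positions_def position_order_of_positions)
  have tco: "total_cyclic_order {1..length w + 2} Z" if "Z \<in> orders_of_word w" for Z
    using that by (simp add: orders_of_word_def)
  show "\<forall>Z\<in>orders_of_word w. order_of_positions (length w + 2) (position Z (length w + 2)) = Z"
    using order_of_position[OF tco] by simp
  show "order_of_positions (length w + 2) ` word_positions w \<subseteq> orders_of_word w"
    using order_of_positions_in_orders_of_word_iff by (auto simp: word_positions_def)
  show "(\<lambda>Z. position Z (length w + 2)) ` orders_of_word w \<subseteq> word_positions w"
  proof (rule image_subsetI)
    fix Z assume Z: "Z \<in> orders_of_word w"
    have "position Z (length w + 2) \<in> positions (length w + 2)"
      by (rule position_in_positions[OF tco[OF Z]]) simp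
    moreover have "order_of_positions (length w + 2) (position Z (length w + 2)) = Z"
      by (rule order_of_position[OF tco[OF Z]]) simp
    ultimately show "position Z (length w + 2) \<in> word_positions w"
      using Z order_of_positions_in_orders_of_word_iff by metis
  qed
qed

subsection \<open>Inserting the last element\<close>

text \<open>This is the increasing map that skips exactly the value \<open>d\<close>: it frees slot
  \<open>d\<close> for the new element without disturbing the cyclic order of the old ones.\<close>

definition shift_pos :: "nat \<Rightarrow> nat \<Rightarrow> nat" where
  "shift_pos d x = (if x < d then x else Suc x)"

definition unshift_pos :: "nat \<Rightarrow> nat \<Rightarrow> nat" where
  "unshift_pos d x = (if x < d then x else x - 1)"

lemma cyc_shift_pos [simp]: "cyc (shift_pos d x) (shift_pos d y) (shift_pos d z) \<longleftrightarrow> cyc x y z"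
  by (auto simp: cyc_def shift_pos_def)

lemma holds_sign_shift_pos [simp]:
  "holds_sign s (shift_pos d x) (shift_pos d y) (shift_pos d z) \<longleftrightarrow> holds_sign s x y z"
  by (cases s) simp_all

lemma unshift_shift_pos [simp]: "unshift_pos d (shift_pos d x) = x"
  by (auto simp: shift_pos_def unshift_pos_def)

lemma shift_unshift_pos: "x \<noteq> d \<Longrightarrow> shift_pos d (unshift_pos d x) = x"
  by (auto simp: shift_pos_def unshift_pos_def)

definition insert_at :: "nat \<Rightarrow> (nat \<Rightarrow> nat) \<Rightarrow> nat \<Rightarrow> nat \<Rightarrow> nat" where
  "insert_at m p d x = (if x = m + 1 then d else if x \<in> {1..m} then shift_pos d (p x) else 0)"

definition delete_last :: "nat \<Rightarrow> (nat \<Rightarrow> nat) \<Rightarrow> nat \<Rightarrow> nat" where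
  "delete_last m p x = (if x \<in> {1..m} then unshift_pos (p (m + 1)) (p x) else 0)"

lemma insert_at_simps [simp]:
  "insert_at m p d (Suc m) = d" "x \<in> {1..m} \<Longrightarrow> insert_at m p d x = shift_pos d (p x)"
  by (auto simp: insert_at_def)

text \<open>The bound \<open>d \<ge> 1\<close> keeps element 1 at position 0. There are
  \<open>m\<close> slots, as there should be for \<open>m\<close> points on a circle;
  \<open>d = m\<close> is the slot that closes the circle just before 1.\<close>

lemma insert_at_positions:
  assumes "p \<in> positions m" "d \<in> {1..m}"
  shows "insert_at m p d \<in> positions (m + 1)"
proof -
  have inj: "p x \<noteq> p y" if "x \<in> {1..m}" "y \<in> {1..m}" "x \<noteq> y" for x y
    using assms that by (auto simp: positions_def dest: inj_onD)
  have "insert_at m p d x \<noteq> insert_at m p d y" if "x \<in> {1..m + 1}" "y \<in> {1..m + 1}" "x \<noteq> y" for x y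
  proof -
    have "x \<in> {1..m} \<or> x = m + 1" "y \<in> {1..m} \<or> y = m + 1" using that by auto
    then consider "x \<in> {1..m}" "y \<in> {1..m}" | "x = m + 1" "y \<in> {1..m}" | "x \<in> {1..m}" "y = m + 1"
      using \<open>x \<noteq> y\<close> by blast
    then show ?thesis
      using inj[of x y] \<open>x \<noteq> y\<close> by cases (auto simp: shift_pos_def split: if_splits)
  qed
  then have "inj_on (insert_at m p d) {1..m + 1}" unfolding inj_on_def by blast
  moreover have "insert_at m p d x < m + 1" for x
  proof (cases "x \<in> {1..m}")
    case True
    then have "p x < m" using assms(1) unfolding positions_def by blast
    then show ?thesis using True by (simp add: shift_pos_def)
  next
    case False
    then show ?thesis using assms(2) by (auto simp: insert_at_def)
  qed
  moreover have "insert_at m p d 1 = 0"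
    using assms by (simp add: positions_def shift_pos_def)
  ultimately show ?thesis by (simp add: positions_def insert_at_def)
qed

lemma delete_last_positions:
  assumes "p \<in> positions (m + 1)" "m \<ge> 1"
  shows "delete_last m p \<in> positions m" "p (m + 1) \<in> {1..m}"
    "x \<in> {1..m} \<Longrightarrow> shift_pos (p (m + 1)) (delete_last m p x) = p x"
proof -
  have inj: "p x \<noteq> p y" if "x \<in> {1..m + 1}" "y \<in> {1..m + 1}" "x \<noteq> y" for x y
    using assms that by (auto simp: positions_def dest: inj_onD)
  have lt: "p x \<le> m" if "x \<in> {1..m + 1}" for x
  proof -
    have "p x < m + 1" using assms(1) that unfolding positions_def by blast
    then show ?thesis by simp
  qed
  have p1: "p 1 = 0" using assms by (simp add: positions_def)
  show d: "p (m + 1) \<in> {1..m}"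
    using inj[of 1 "m + 1"] lt[of "m + 1"] p1 assms(2) by simp
  show *: "shift_pos (p (m + 1)) (delete_last m p x) = p x" if "x \<in> {1..m}" for x
    using that inj[of x "m + 1"] by (simp add: delete_last_def shift_unshift_pos)
  have "inj_on (delete_last m p) {1..m}"
  proof (rule inj_onI)
    fix x y assume "x \<in> {1..m}" "y \<in> {1..m}" "delete_last m p x = delete_last m p y"
    then show "x = y" using *[of x] *[of y] inj[of x y] by auto
  qed
  moreover have "delete_last m p x < m" if "x \<in> {1..m}" for x
    using *[OF that] lt[of x] d that by (auto simp: shift_pos_def split: if_splits)
  moreover have "delete_last m p 1 = 0"
    using p1 by (simp add: delete_last_def unshift_pos_def)
  ultimately show "delete_last m p \<in> positions m"
    by (simp add: positions_def delete_last_def)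
qed

lemma delete_last_insert_at:
  assumes "p \<in> positions m"
  shows "delete_last m (insert_at m p d) = p"
  using assms by (auto simp: delete_last_def positions_def)

lemma insert_at_delete_last:
  assumes "p \<in> positions (m + 1)" "m \<ge> 1"
  shows "insert_at m (delete_last m p) (p (m + 1)) = p"
proof
  fix x
  show "insert_at m (delete_last m p) (p (m + 1)) x = p x"
    using delete_last_positions(3)[OF assms, of x] assms(1)
    by (auto simp: insert_at_def positions_def)
qed

text \<open>The letters of \<open>w\<close> speak only of old elements, whose cyclic order survives
  the insertion. The appended letter concerns the last two old elements and the new one.\<close>

lemma word_positions_snoc_iff:
  assumes p: "p \<in> positions (length w + 2)" and d: "d \<in> {1..length w + 2}"
  shows "insert_at (length w + 2) p d \<in> word_positions (w @ [s]) \<longleftrightarrow>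
    p \<in> word_positions w \<and>
    holds_sign s (shift_pos d (p (length w + 1))) (shift_pos d (p (length w + 2))) d"
proof -
  let ?q = "insert_at (length w + 2) p d"
  have "?q \<in> word_positions (w @ [s]) \<longleftrightarrow>
      (\<forall>i<length w + 1. holds_sign ((w @ [s]) ! i) (?q (i + 1)) (?q (i + 2)) (?q (i + 3)))"
    using insert_at_positions[OF p d] by (simp add: word_positions_def)
  also have "\<dots> \<longleftrightarrow> (\<forall>i<length w. holds_sign (w ! i) (?q (i + 1)) (?q (i + 2)) (?q (i + 3))) \<and>
      holds_sign s (?q (length w + 1)) (?q (length w + 2)) (?q (length w + 3))"
    by (auto simp: less_Suc_eq nth_append)
  also have "(\<forall>i<length w. holds_sign (w ! i) (?q (i + 1)) (?q (i + 2)) (?q (i + 3))) \<longleftrightarrow>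
      (\<forall>i<length w. holds_sign (w ! i) (p (i + 1)) (p (i + 2)) (p (i + 3)))"
  proof (intro all_cong)
    fix i assume "i < length w"
    then have "i + 1 \<in> {1..length w + 2}" "i + 2 \<in> {1..length w + 2}" "i + 3 \<in> {1..length w + 2}" by auto
    then show "holds_sign (w ! i) (?q (i + 1)) (?q (i + 2)) (?q (i + 3)) \<longleftrightarrow>
        holds_sign (w ! i) (p (i + 1)) (p (i + 2)) (p (i + 3))"
      by (simp only: insert_at_simps holds_sign_shift_pos)
  qed
  also have "(\<forall>i<length w. holds_sign (w ! i) (p (i + 1)) (p (i + 2)) (p (i + 3))) \<longleftrightarrow> p \<in> word_positions w"
    using p by (simp add: word_positions_def)
  also have "?q (length w + 3) = d"
    by (simp add: insert_at_def)
  finally show ?thesis by simp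
qed

text \<open>For the longer word the marked elements are 2, \<open>m\<close> and
  \<open>m + 1\<close>, so the summand \<open>f\<close> sees nothing else. The old marked element
  \<open>m - 1\<close> enters only through the sign condition that decides which slots
  \<open>d\<close> are admissible.\<close>

lemma sum_word_positions_snoc:
  fixes f :: "nat \<Rightarrow> nat \<Rightarrow> nat \<Rightarrow> 'b::comm_monoid_add"
  assumes "m = length w + 2"
  shows "(\<Sum>q\<in>word_positions (w @ [s]). f (q 2) (q m) (q (m + 1))) =
    (\<Sum>p\<in>word_positions w. \<Sum>d = 1..m.
      if holds_sign s (shift_pos d (p (m - 1))) (shift_pos d (p m)) d
      then f (shift_pos d (p 2)) (shift_pos d (p m)) d else 0)"
proof -
  let ?c = "\<lambda>p d. holds_sign s (shift_pos d (p (m - 1))) (shift_pos d (p m)) d"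
  let ?S = "Sigma (word_positions w) (\<lambda>p. {d \<in> {1..m}. ?c p d})"
  have w: "word_positions w \<subseteq> positions m" and ws: "word_positions (w @ [s]) \<subseteq> positions (m + 1)"
    using assms by (auto simp: word_positions_def)
  have ins: "insert_at m p d \<in> word_positions (w @ [s]) \<longleftrightarrow> p \<in> word_positions w \<and> ?c p d"
    if "p \<in> positions m" "d \<in> {1..m}" for p d
    using word_positions_snoc_iff[of p w d s] that assms by simp
  have "(\<Sum>q\<in>word_positions (w @ [s]). f (q 2) (q m) (q (m + 1))) =
      (\<Sum>(p, d)\<in>?S. f (shift_pos d (p 2)) (shift_pos d (p m)) d)"
  proof (rule sum.reindex_bij_witness[where j = "\<lambda>q. (delete_last m q, q (m + 1))" and i = "\<lambda>(p, d). insert_at m p d"])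
    fix q assume "q \<in> word_positions (w @ [s])"
    then have q: "q \<in> word_positions (w @ [s])" "q \<in> positions (m + 1)" using ws by auto
    have m: "m \<ge> 1" using assms by simp
    show "(case (delete_last m q, q (m + 1)) of (p, d) \<Rightarrow> insert_at m p d) = q"
      using insert_at_delete_last[OF q(2) m] by simp
    then show "(delete_last m q, q (m + 1)) \<in> ?S"
      using ins[OF delete_last_positions(1,2)[OF q(2) m]] q(1) delete_last_positions(2)[OF q(2) m] by simp
    show "(case (delete_last m q, q (m + 1)) of (p, d) \<Rightarrow> f (shift_pos d (p 2)) (shift_pos d (p m)) d) =
        f (q 2) (q m) (q (m + 1))"
      using delete_last_positions(3)[OF q(2) m, of 2] delete_last_positions(3)[OF q(2) m, of m] assms by simp
  next
    fix pd assume pd: "pd \<in> ?S"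
    obtain p d where [simp]: "pd = (p, d)" by (cases pd)
    have p: "p \<in> word_positions w" "p \<in> positions m" and d: "d \<in> {1..m}" "?c p d" using pd w by auto
    show "(delete_last m (case pd of (p, d) \<Rightarrow> insert_at m p d), (case pd of (p, d) \<Rightarrow> insert_at m p d) (m + 1)) = pd"
      using delete_last_insert_at[OF p(2)] by simp
    show "(case pd of (p, d) \<Rightarrow> insert_at m p d) \<in> word_positions (w @ [s])"
      using ins[OF p(2) d(1)] p(1) d(2) by simp
  qed
  also have "\<dots> = (\<Sum>p\<in>word_positions w. \<Sum>d\<in>{d \<in> {1..m}. ?c p d}. f (shift_pos d (p 2)) (shift_pos d (p m)) d)"
    by (rule sum.Sigma[symmetric]) (auto simp: finite_word_positions)
  also have "\<dots> = (\<Sum>p\<in>word_positions w. \<Sum>d = 1..m. if ?c p d then f (shift_pos d (p 2)) (shift_pos d (p m)) d else 0)"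
    by (intro sum.cong refl sum.inter_filter) simp
  finally show ?thesis .
qed

subsection \<open>Gap monomials\<close>

definition monom4 :: "nat \<Rightarrow> nat \<Rightarrow> nat \<Rightarrow> nat \<Rightarrow> poly4" where
  "monom4 i j k l = X 1 ^ i * X 2 ^ j * X 3 ^ k * X 4 ^ l"

lemma X_power: "X v ^ e = Poly_Mapping.single (Poly_Mapping.single v e) 1"
proof (induction e)
  case 0
  show ?case by simp
next
  case (Suc e)
  have "X v ^ Suc e = X v * Poly_Mapping.single (Poly_Mapping.single v e) 1"
    by (simp only: power_Suc Suc.IH)
  also have "\<dots> = Poly_Mapping.single (Poly_Mapping.single v (1 + e)) 1"
    by (simp only: X_def mult_single single_add mult_1)
  finally show ?case by simp
qed

text \<open>\<open>frag_extend\<close> is known directly only on basis elements, so the monomial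
  must be exhibited as one before \<open>Phi\<close> can be evaluated on it.\<close>

lemma monom4_eq_single:
  "monom4 i j k l = Poly_Mapping.single (Poly_Mapping.single 1 i + Poly_Mapping.single 2 j +
     Poly_Mapping.single 3 k + Poly_Mapping.single 4 l) 1"
  by (simp only: monom4_def X_power mult_single mult_1)

lemma UNIV_4: "(UNIV :: 4 set) = {1, 2, 3, 4}"
proof -
  have "card {1, 2, 3, 4 :: 4} = CARD(4)" by simp
  then show ?thesis by (intro card_subset_eq[symmetric]) auto
qed

text \<open>The last branch of \<open>e\<close> belongs to the variable index 4, which is 0 in the
  index type. Writing the index set of the product out explicitly allows it to be evaluated for
  concrete \<open>b\<close> and \<open>c\<close>.\<close>

lemma Phi_monom4:
  fixes i j k l
  defines "e \<equiv> (\<lambda>v::4. if v = 1 then i else if v = 2 then j else if v = 3 then k else l)"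
  shows "Phi a b c (monom4 i j k l) =
    (\<Prod>v\<in>{1, 2, 3, 4} - {b, c}. X v ^ e v) * X a ^ (e b + 1) *
    (\<Sum>t\<le>e c. X b ^ (e c - t) * X c ^ t)"
proof -
  let ?m = "Poly_Mapping.single 1 i + Poly_Mapping.single 2 j +
     Poly_Mapping.single 3 k + Poly_Mapping.single 4 l :: expo"
  have "Poly_Mapping.lookup ?m v = e v" for v
  proof -
    have "v \<in> {1, 2, 3, 4}" using UNIV_4 by blast
    then consider "v = 1" | "v = 2" | "v = 3" | "v = 4" by blast
    then show ?thesis
      by cases (simp_all add: e_def lookup_add lookup_single)
  qed
  then show ?thesis
    by (simp add: Phi_def monom4_eq_single UNIV_4 atLeast0AtMost)
qed

lemma Phi_0: "Phi a b c 0 = 0" by (simp add: Phi_def)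

lemma Phi_sum: "finite I \<Longrightarrow> Phi a b c (\<Sum>i\<in>I. f i) = (\<Sum>i\<in>I. Phi a b c (f i))"
  by (simp add: Phi_def frag_extend_sum)

text \<open>
  The gap monomials of the six regions, for \<open>2\<close>, \<open>m - 1\<close>, \<open>m\<close> at positions \<open>a\<close>, \<open>b\<close>, \<open>c\<close>.
\<close>

definition weight1 :: "nat \<Rightarrow> nat \<Rightarrow> nat \<Rightarrow> nat \<Rightarrow> poly4" where
  "weight1 m a b c = (if a < b \<and> b < c then monom4 (c - b - 1) (m - c - 1) (a - 1) (b - a - 1) else 0)"

text \<open>In every region \<open>X 3\<close> marks the gap following 1 and \<open>X 2\<close> the
  gap preceding 1. The two inner gaps carry \<open>X 1\<close> and then \<open>X 4\<close> here and
  in \<open>weight5\<close>, but \<open>X 4\<close> and then \<open>X 1\<close> in the other four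
  regions.\<close>

definition weight2 :: "nat \<Rightarrow> nat \<Rightarrow> nat \<Rightarrow> nat \<Rightarrow> poly4" where
  "weight2 m a b c = (if b < a \<and> a < c then monom4 (a - b - 1) (m - c - 1) (b - 1) (c - a - 1) else 0)"

definition weight3 :: "nat \<Rightarrow> nat \<Rightarrow> nat \<Rightarrow> nat \<Rightarrow> poly4" where
  "weight3 m a b c = (if b < c \<and> c < a then monom4 (a - c - 1) (m - a - 1) (b - 1) (c - b - 1) else 0)"

definition weight4 :: "nat \<Rightarrow> nat \<Rightarrow> nat \<Rightarrow> nat \<Rightarrow> poly4" where
  "weight4 m a b c = (if a < c \<and> c < b then monom4 (b - c - 1) (m - b - 1) (a - 1) (c - a - 1) else 0)"

definition weight5 :: "nat \<Rightarrow> nat \<Rightarrow> nat \<Rightarrow> nat \<Rightarrow> poly4" where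
  "weight5 m a b c = (if c < a \<and> a < b then monom4 (a - c - 1) (m - b - 1) (c - 1) (b - a - 1) else 0)"

definition weight6 :: "nat \<Rightarrow> nat \<Rightarrow> nat \<Rightarrow> nat \<Rightarrow> poly4" where
  "weight6 m a b c = (if c < b \<and> b < a then monom4 (a - b - 1) (m - a - 1) (c - 1) (b - c - 1) else 0)"

lemmas weight_defs = weight1_def weight2_def weight3_def weight4_def weight5_def weight6_def

section \<open>Insertion identities for a single position function\<close>

definition insertion_sum ::
  "sign \<Rightarrow> (nat \<Rightarrow> nat \<Rightarrow> nat \<Rightarrow> nat \<Rightarrow> poly4) \<Rightarrow> nat \<Rightarrow> nat \<Rightarrow> nat \<Rightarrow> nat \<Rightarrow> poly4" where
  "insertion_sum s W m a b c = (\<Sum>d = 1..m.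
     if holds_sign s (shift_pos d b) (shift_pos d c) d
     then W (m + 1) (shift_pos d a) (shift_pos d c) d else 0)"

text \<open>The slots are sorted by the gap that receives the new element, when 1 and the three
  marked elements cut the circle into gaps of sizes \<open>n0\<close>, ..., \<open>n3\<close>. A gap
  of size \<open>n\<close> offers \<open>n + 1\<close> slots, and \<open>t\<close> is the number of
  its elements that come before the new one.\<close>

lemma sum_over_gaps:
  fixes f :: "nat \<Rightarrow> 'b::comm_monoid_add"
  shows "sum f {1..n0 + n1 + n2 + n3 + 4} = (\<Sum>t\<le>n0. f (t + 1)) + (\<Sum>t\<le>n1. f (t + (n0 + 2))) +
    (\<Sum>t\<le>n2. f (t + (n0 + n1 + 3))) + (\<Sum>t\<le>n3. f (t + (n0 + n1 + n2 + 4)))"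
proof -
  have block: "(\<Sum>t\<le>n. f (t + u)) = sum f {u..u + n}" for n u
    using sum.shift_bounds_cl_nat_ivl[of f 0 u n] by (simp add: atLeast0AtMost add.commute)
  have "sum f {1..n0 + n1 + n2 + n3 + 4} =
      sum f {1..n0 + n1 + n2 + 3} + sum f {n0 + n1 + n2 + 4..n0 + n1 + n2 + 4 + n3}"
    using sum.ub_add_nat[of 1 "n0 + n1 + n2 + 3" f "n3 + 1"] by (simp add: ac_simps)
  also have "sum f {1..n0 + n1 + n2 + 3} =
      sum f {1..n0 + n1 + 2} + sum f {n0 + n1 + 3..n0 + n1 + 3 + n2}"
    using sum.ub_add_nat[of 1 "n0 + n1 + 2" f "n2 + 1"] by (simp add: ac_simps numeral_3_eq_3)
  also have "sum f {1..n0 + n1 + 2} = sum f {1..1 + n0} + sum f {n0 + 2..n0 + 2 + n1}"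
    using sum.ub_add_nat[of 1 "n0 + 1" f "n1 + 1"] by (simp add: ac_simps)
  finally show ?thesis
    by (simp only: block)
qed

text \<open>Writing \<open>n = t + u\<close> removes the truncated subtraction \<open>n - t\<close>
  from exponents, so that summands can be compared by collecting powers.\<close>

lemma sum_atMost_eqI:
  assumes "\<And>t u. n = t + u \<Longrightarrow> f t = g t"
  shows "sum f {..n} = sum g {..n::nat}"
  by (rule sum.cong[OF refl]) (auto simp: le_iff_add dest: assms)

text \<open>This version serves the cases where one side counts the elements of the split gap before
  the new element and the other side those after it.\<close>

lemma sum_atMost_reverse_eqI:
  assumes "\<And>t u. n = t + u \<Longrightarrow> f t = g u"
  shows "sum f {..n} = sum g {..n::nat}"
  by (rule sum.reindex_bij_witness[of _ "\<lambda>t. n - t" "\<lambda>t. n - t"]) (auto simp: assms[symmetric])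

text \<open>These are the twelve recurrences with each polynomial replaced by the contribution of
  one position function. For distinct \<open>a\<close>, \<open>b\<close>, \<open>c\<close> exactly
  one of the six order conditions holds, so each right-hand side reduces to at most one
  term.\<close>

definition insertion_rules :: "nat \<Rightarrow> nat \<Rightarrow> nat \<Rightarrow> nat \<Rightarrow> bool" where
  "insertion_rules m a b c \<longleftrightarrow>
     (insertion_sum Plus weight1 m a b c =
       Phi 4 1 2 (weight1 m a b c) + Phi 3 1 2 (weight2 m a b c) + Phi 2 2 1 (weight4 m a b c) \<and>
     insertion_sum Plus weight2 m a b c =
       Phi 3 4 2 (weight3 m a b c) + Phi 2 2 4 (weight5 m a b c) \<and>
     insertion_sum Plus weight3 m a b c =
       Phi 3 4 1 (weight3 m a b c) + Phi 2 4 1 (weight5 m a b c) + Phi 1 1 4 (weight6 m a b c) \<and>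
     insertion_sum Plus weight4 m a b c = Phi 1 1 4 (weight1 m a b c) \<and>
     insertion_sum Plus weight5 m a b c = Phi 4 1 3 (weight1 m a b c) + Phi 1 1 3 (weight2 m a b c) \<and>
     insertion_sum Plus weight6 m a b c = Phi 4 4 3 (weight3 m a b c)) \<and>
     (insertion_sum Minus weight1 m a b c = Phi 1 1 2 (weight4 m a b c) \<and>
     insertion_sum Minus weight2 m a b c = Phi 1 4 2 (weight6 m a b c) + Phi 4 4 2 (weight5 m a b c) \<and>
     insertion_sum Minus weight3 m a b c = Phi 4 4 1 (weight6 m a b c) \<and>
     insertion_sum Minus weight4 m a b c =
       Phi 2 1 4 (weight4 m a b c) + Phi 3 1 4 (weight2 m a b c) + Phi 4 4 1 (weight1 m a b c) \<and>
     insertion_sum Minus weight5 m a b c = Phi 2 1 3 (weight4 m a b c) + Phi 3 3 1 (weight2 m a b c) \<and>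
     insertion_sum Minus weight6 m a b c =
       Phi 1 4 3 (weight6 m a b c) + Phi 2 4 3 (weight5 m a b c) + Phi 3 3 4 (weight3 m a b c))"

text \<open>In circular order starting from 1 the gaps carry \<open>X 3\<close>, \<open>X 4\<close>,
  \<open>X 1\<close>, \<open>X 2\<close>. The sign \<open>Plus\<close> puts the new element on the
  arc from \<open>m\<close> forward to \<open>m - 1\<close>, which here comprises three gaps;
  \<open>Minus\<close> leaves only the gap between \<open>m - 1\<close> and \<open>m\<close>.
  Forgetting \<open>m - 1\<close> merges the gaps of \<open>X 4\<close> and \<open>X 1\<close> and
  adds one element, hence the exponent \<open>i_b + 1\<close> in \<open>Phi a b c\<close>. If the
  split gap is neither of these, one variable of the merged pair becomes free to mark a half of the
  split gap. If it is one of them, the half next to \<open>m - 1\<close> joins the other gap of the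
  pair, which is the case \<open>a = b\<close> of \<open>Phi\<close>.\<close>

lemma insertion_rules_abc:
  fixes n0 n1 n2 n3
  shows "insertion_rules (n0 + n1 + n2 + n3 + 4) (n0 + 1) (n0 + n1 + 2) (n0 + n1 + n2 + 3)"
  unfolding insertion_rules_def insertion_sum_def sum_over_gaps
  apply (intro conjI)
  \<comment> \<open>The concrete positions decide every comparison, so each of the four blocks
    either vanishes entirely or becomes an unconditional sum, and only one weight survives on the
    right.\<close>
  apply (simp_all add: weight_defs shift_pos_def cyc_def Phi_0 Phi_monom4 insert_Diff_if cong: sum.cong_simp)
  apply (simp_all only: monom4_def sum_distrib_left)
  \<comment> \<open>The index in \<open>Phi\<close> is the exponent of \<open>X c\<close>, which may
    mark the half of the split gap before or after the new element; accordingly the sums agree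
    directly or after reversal.\<close>
  by ((rule sum_atMost_eqI, (simp add: power_add mult_ac; fail)) | (rule sum_atMost_reverse_eqI, (simp add: power_add mult_ac; fail)))+

lemma insertion_rules_acb:
  fixes n0 n1 n2 n3
  shows "insertion_rules (n0 + n1 + n2 + n3 + 4) (n0 + 1) (n0 + n1 + n2 + 3) (n0 + n1 + 2)"
  unfolding insertion_rules_def insertion_sum_def sum_over_gaps
  apply (intro conjI)
  apply (simp_all add: weight_defs shift_pos_def cyc_def Phi_0 Phi_monom4 insert_Diff_if cong: sum.cong_simp)
  apply (simp_all only: monom4_def sum_distrib_left)
  by ((rule sum_atMost_eqI, (simp add: power_add mult_ac; fail)) | (rule sum_atMost_reverse_eqI, (simp add: power_add mult_ac; fail)))+

text \<open>Here \<open>m - 1\<close> comes first after 1, so the gaps of \<open>X 3\<close> and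
  \<open>X 1\<close> merge. Since 1 and 2 lie on different arcs between \<open>m - 1\<close> and
  \<open>m\<close>, each sign admits two gaps.\<close>

lemma insertion_rules_bac:
  fixes n0 n1 n2 n3
  shows "insertion_rules (n0 + n1 + n2 + n3 + 4) (n0 + n1 + 2) (n0 + 1) (n0 + n1 + n2 + 3)"
  unfolding insertion_rules_def insertion_sum_def sum_over_gaps
  apply (intro conjI)
  apply (simp_all add: weight_defs shift_pos_def cyc_def Phi_0 Phi_monom4 insert_Diff_if cong: sum.cong_simp)
  apply (simp_all only: monom4_def sum_distrib_left)
  by ((rule sum_atMost_eqI, (simp add: power_add mult_ac; fail)) | (rule sum_atMost_reverse_eqI, (simp add: power_add mult_ac; fail)))+

lemma insertion_rules_bca:
  fixes n0 n1 n2 n3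
  shows "insertion_rules (n0 + n1 + n2 + n3 + 4) (n0 + n1 + n2 + 3) (n0 + 1) (n0 + n1 + 2)"
  unfolding insertion_rules_def insertion_sum_def sum_over_gaps
  apply (intro conjI)
  apply (simp_all add: weight_defs shift_pos_def cyc_def Phi_0 Phi_monom4 insert_Diff_if cong: sum.cong_simp)
  apply (simp_all only: monom4_def sum_distrib_left)
  by ((rule sum_atMost_eqI, (simp add: power_add mult_ac; fail)) | (rule sum_atMost_reverse_eqI, (simp add: power_add mult_ac; fail)))+

lemma insertion_rules_cab:
  fixes n0 n1 n2 n3
  shows "insertion_rules (n0 + n1 + n2 + n3 + 4) (n0 + n1 + 2) (n0 + n1 + n2 + 3) (n0 + 1)"
  unfolding insertion_rules_def insertion_sum_def sum_over_gaps
  apply (intro conjI)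
  apply (simp_all add: weight_defs shift_pos_def cyc_def Phi_0 Phi_monom4 insert_Diff_if cong: sum.cong_simp)
  apply (simp_all only: monom4_def sum_distrib_left)
  by ((rule sum_atMost_eqI, (simp add: power_add mult_ac; fail)) | (rule sum_atMost_reverse_eqI, (simp add: power_add mult_ac; fail)))+

lemma insertion_rules_cba:
  fixes n0 n1 n2 n3
  shows "insertion_rules (n0 + n1 + n2 + n3 + 4) (n0 + n1 + n2 + 3) (n0 + n1 + 2) (n0 + 1)"
  unfolding insertion_rules_def insertion_sum_def sum_over_gaps
  apply (intro conjI)
  apply (simp_all add: weight_defs shift_pos_def cyc_def Phi_0 Phi_monom4 insert_Diff_if cong: sum.cong_simp)
  apply (simp_all only: monom4_def sum_distrib_left)
  by ((rule sum_atMost_eqI, (simp add: power_add mult_ac; fail)) | (rule sum_atMost_reverse_eqI, (simp add: power_add mult_ac; fail)))+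

subsection \<open>The generating polynomials as sums over position functions\<close>

lemma insertion_rules:
  assumes "distinct [a, b, c]" "{a, b, c} \<subseteq> {1..<m}"
  shows "insertion_rules m a b c"
proof -
  have gaps: "\<exists>n0 n1 n2 n3. u = n0 + 1 \<and> v = n0 + n1 + 2 \<and> x = n0 + n1 + n2 + 3 \<and> m = n0 + n1 + n2 + n3 + 4"
    if "0 < u" "u < v" "v < x" "x < m" for u v x
    using that
    by (intro exI[of _ "u - 1"] exI[of _ "v - u - 1"] exI[of _ "x - v - 1"] exI[of _ "m - x - 1"]) auto
  have "0 < a" "0 < b" "0 < c" "a < m" "b < m" "c < m" using assms(2) by auto
  consider "a < b" "b < c" | "a < c" "c < b" | "b < a" "a < c" | "b < c" "c < a" | "c < a" "a < b" | "c < b" "b < a"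
    using assms(1) by force
  then show ?thesis
  proof cases
    case 1 then show ?thesis using gaps[of a b c] \<open>0 < a\<close> \<open>c < m\<close> insertion_rules_abc by metis
  next
    case 2 then show ?thesis using gaps[of a c b] \<open>0 < a\<close> \<open>b < m\<close> insertion_rules_acb by metis
  next
    case 3 then show ?thesis using gaps[of b a c] \<open>0 < b\<close> \<open>c < m\<close> insertion_rules_bac by metis
  next
    case 4 then show ?thesis using gaps[of b c a] \<open>0 < b\<close> \<open>a < m\<close> insertion_rules_bca by metis
  next
    case 5 then show ?thesis using gaps[of c a b] \<open>0 < c\<close> \<open>b < m\<close> insertion_rules_cab by metis
  next
    case 6 then show ?thesis using gaps[of c b a] \<open>0 < c\<close> \<open>a < m\<close> insertion_rules_cba by metis
  qed
qed

text \<open>Grouping the elements of \<open>S\<close> by their exponent vector turns each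
  coefficient into a sum of equal monomials. The degree condition places every exponent vector in
  the index set of \<open>gen_poly\<close>.\<close>

lemma gen_poly_card_eq_sum:
  assumes "finite S" and "\<And>Z. Z \<in> S \<Longrightarrow> A Z + B Z + C Z + D Z = n - 2"
  shows "gen_poly n (\<lambda>i j k l. card {Z \<in> S. A Z = i \<and> B Z = j \<and> C Z = k \<and> D Z = l}) =
    (\<Sum>Z\<in>S. monom4 (A Z) (B Z) (C Z) (D Z))"
proof -
  let ?T = "{(i, j, k, l). i + j + k + l = n - 2}"
  let ?e = "\<lambda>Z. (A Z, B Z, C Z, D Z)"
  have "?T \<subseteq> {..n} \<times> {..n} \<times> {..n} \<times> {..n}" by auto
  then have fin: "finite ?T" by (rule finite_subset) auto
  have "of_nat (card {Z \<in> S. A Z = i \<and> B Z = j \<and> C Z = k \<and> D Z = l}) * X 1 ^ i * X 2 ^ j * X 3 ^ k * X 4 ^ l =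
      (\<Sum>Z\<in>{Z \<in> S. ?e Z = (i, j, k, l)}. monom4 (A Z) (B Z) (C Z) (D Z))" for i j k l
  proof -
    have "(\<Sum>Z\<in>{Z \<in> S. ?e Z = (i, j, k, l)}. monom4 (A Z) (B Z) (C Z) (D Z)) =
        (\<Sum>Z\<in>{Z \<in> S. ?e Z = (i, j, k, l)}. monom4 i j k l)"
      by (rule sum.cong) auto
    then show ?thesis by (simp add: monom4_def mult.assoc)
  qed
  then have "gen_poly n (\<lambda>i j k l. card {Z \<in> S. A Z = i \<and> B Z = j \<and> C Z = k \<and> D Z = l}) =
      (\<Sum>t\<in>?T. \<Sum>Z\<in>{Z \<in> S. ?e Z = t}. monom4 (A Z) (B Z) (C Z) (D Z))"
    unfolding gen_poly_def by (intro sum.cong refl) (auto split: prod.splits)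
  also have "\<dots> = (\<Sum>Z\<in>S. monom4 (A Z) (B Z) (C Z) (D Z))"
    by (rule sum.group[OF assms(1) fin]) (auto simp: assms(2))
  finally show ?thesis .
qed

lemma is_chain_4:
  "is_chain Z [a, b, c, d] \<longleftrightarrow> distinct [a, b, c, d] \<and> (a, b, c) \<in> Z \<and> (a, c, d) \<in> Z"
proof -
  have "{3..length [a, b, c, d]} = {3, 4}" by auto
  then show ?thesis unfolding is_chain_def by simp
qed

lemma gap_counts_4:
  "gap_counts Z [a, b, c, d] =
    [between_count Z a b, between_count Z b c, between_count Z c d, between_count Z d a]"
  by (simp add: gap_counts_def)

lemma positions_pos:
  assumes "p \<in> positions m" "x \<in> {2..m}"
  shows "0 < p x" "p x < m"
proof -
  have "p x \<noteq> p 1"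
    using assms inj_onD[of p "{1..m}" x 1] by (auto simp: positions_def)
  then show "0 < p x" "p x < m" using assms by (auto simp: positions_def)
qed

text \<open>As 1 has position 0, below all others, cyclic order seen from 1 is the linear order of
  positions.\<close>

lemma is_chain_order_of_positions:
  assumes "p \<in> positions m" "{x, y, z} \<subseteq> {2..m}"
  shows "is_chain (order_of_positions m p) [1, x, y, z] \<longleftrightarrow> p x < p y \<and> p y < p z"
proof -
  have "p 1 = 0" using assms(1) by (simp add: positions_def)
  moreover have "0 < p x" "0 < p y" "0 < p z" using assms positions_pos by auto
  ultimately show ?thesis
    using assms(2) by (auto simp: is_chain_4 order_of_positions_def cyc_def)
qed

text \<open>One statement covers all six families: \<open>x\<close>, \<open>y\<close>,
  \<open>z\<close> will be 2, \<open>m - 1\<close>, \<open>m\<close> in the order of the region,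
  \<open>A\<close> to \<open>D\<close> the gap counts in the order of the variables, and
  \<open>V\<close> the weight. The positivity and bounds offered to the last two assumptions reduce
  them to arithmetic.\<close>

lemma gen_poly_chain_orders:
  assumes m: "m = length w + 2" and xyz: "{x, y, z} \<subseteq> {2..m}"
    and sum: "\<And>p. \<lbrakk>p \<in> positions m; p 1 = 0; 0 < p x; p x < m; 0 < p y; p y < m; 0 < p z; p z < m;
      p x < p y; p y < p z\<rbrakk> \<Longrightarrow>
      A (order_of_positions m p) + B (order_of_positions m p) +
      C (order_of_positions m p) + D (order_of_positions m p) = length w - 2"
    and V: "\<And>p. \<lbrakk>p \<in> positions m; p 1 = 0; 0 < p x; p x < m; 0 < p y; p y < m; 0 < p z; p z < m\<rbrakk> \<Longrightarrow>
      V p = (if p x < p y \<and> p y < p z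
      then monom4 (A (order_of_positions m p)) (B (order_of_positions m p))
        (C (order_of_positions m p)) (D (order_of_positions m p)) else 0)"
  shows "gen_poly (length w)
      (\<lambda>i j k l. card {Z \<in> chain_orders w [1, x, y, z]. A Z = i \<and> B Z = j \<and> C Z = k \<and> D Z = l}) =
    (\<Sum>p\<in>word_positions w. V p)"
proof -
  let ?O = "order_of_positions m"
  let ?M = "\<lambda>Z. monom4 (A Z) (B Z) (C Z) (D Z)"
  have bij: "bij_betw ?O (word_positions w) (orders_of_word w)"
    using bij_betw_order_of_positions m by simp
  have pos: "p \<in> positions m" if "p \<in> word_positions w" for p
    using that m by (simp add: word_positions_def)
  have range: "p 1 = 0" "0 < p x" "p x < m" "0 < p y" "p y < m" "0 < p z" "p z < m"
    if "p \<in> positions m" for p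
    using positions_pos[OF that] xyz that by (auto simp: positions_def)
  have fin: "finite (orders_of_word w)"
    using bij finite_word_positions bij_betw_finite by blast
  have "gen_poly (length w)
      (\<lambda>i j k l. card {Z \<in> chain_orders w [1, x, y, z]. A Z = i \<and> B Z = j \<and> C Z = k \<and> D Z = l}) =
    (\<Sum>Z\<in>chain_orders w [1, x, y, z]. ?M Z)"
  proof (rule gen_poly_card_eq_sum)
    show "finite (chain_orders w [1, x, y, z])" using fin by (simp add: chain_orders_def)
    fix Z assume "Z \<in> chain_orders w [1, x, y, z]"
    then have Z: "Z \<in> orders_of_word w" "is_chain Z [1, x, y, z]" by (auto simp: chain_orders_def)
    then obtain p where p: "p \<in> word_positions w" "Z = ?O p"
      using bij by (auto simp: bij_betw_def)
    show "A Z + B Z + C Z + D Z = length w - 2"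
      using sum[OF pos[OF p(1)] range[OF pos[OF p(1)]]] Z(2) is_chain_order_of_positions[OF pos[OF p(1)] xyz] p(2) by simp
  qed
  also have "\<dots> = (\<Sum>Z\<in>orders_of_word w. if is_chain Z [1, x, y, z] then ?M Z else 0)"
    unfolding chain_orders_def using fin by (rule sum.inter_filter)
  also have "\<dots> = (\<Sum>p\<in>word_positions w. if is_chain (?O p) [1, x, y, z] then ?M (?O p) else 0)"
    by (rule sum.reindex_bij_betw[OF bij, symmetric])
  also have "\<dots> = (\<Sum>p\<in>word_positions w. V p)"
  proof (rule sum.cong[OF refl])
    fix p assume "p \<in> word_positions w"
    note p = pos[OF this]
    show "(if is_chain (?O p) [1, x, y, z] then ?M (?O p) else 0) = V p"
      using is_chain_order_of_positions[OF p xyz] V[OF p range[OF p]] by simp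
  qed
  finally show ?thesis .
qed

lemma
  assumes len: "length w \<ge> 2" and m: "m = length w + 2"
  shows R1_eq_sum: "R1 w = (\<Sum>p\<in>word_positions w. weight1 m (p 2) (p (m - 1)) (p m))"
    and R2_eq_sum: "R2 w = (\<Sum>p\<in>word_positions w. weight2 m (p 2) (p (m - 1)) (p m))"
    and R3_eq_sum: "R3 w = (\<Sum>p\<in>word_positions w. weight3 m (p 2) (p (m - 1)) (p m))"
    and R4_eq_sum: "R4 w = (\<Sum>p\<in>word_positions w. weight4 m (p 2) (p (m - 1)) (p m))"
    and R5_eq_sum: "R5 w = (\<Sum>p\<in>word_positions w. weight5 m (p 2) (p (m - 1)) (p m))"
    and R6_eq_sum: "R6 w = (\<Sum>p\<in>word_positions w. weight6 m (p 2) (p (m - 1)) (p m))"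
proof -
  \<comment> \<open>A word of length at least 2 makes 1, 2, \<open>m - 1\<close>, \<open>m\<close>
    four different elements; the other \<open>m - 4\<close> elements are distributed over the gaps,
    which accounts for the total degree.\<close>
  have m4: "length w - 2 = m - 4" "m \<ge> 4" using len m by auto
  have mem: "{2, m - 1, m} \<subseteq> {2..m}" using m4 by auto
  have count: "between_count (order_of_positions m p) x z =
      (if p x \<le> p z then p z - p x - 1 else m - p x - 1 + p z)"
    if "p \<in> positions m" "x \<in> {1, 2, m - 1, m}" "z \<in> {1, 2, m - 1, m}" for p x z
    using that(2,3) m4 by (intro between_count_order_of_positions[OF that(1)]) auto
  let ?c = between_count
  have "R1 w = gen_poly (length w) (\<lambda>i j k l. card {Z \<in> chain_orders w [1, 2, m - 1, m].
      ?c Z (m - 1) m = i \<and> ?c Z m 1 = j \<and> ?c Z 1 2 = k \<and> ?c Z 2 (m - 1) = l})"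
    by (simp only: R1_def g1_def[abs_def] RR1_def Let_def m[symmetric] gap_counts_4 list.inject simp_thms)
  also have "\<dots> = (\<Sum>p\<in>word_positions w. weight1 m (p 2) (p (m - 1)) (p m))"
  proof (rule gen_poly_chain_orders[OF m])
    show "{2, m - 1, m} \<subseteq> {2..m}" using mem by simp
  qed (simp_all add: m4 count weight1_def)
  finally show "R1 w = (\<Sum>p\<in>word_positions w. weight1 m (p 2) (p (m - 1)) (p m))" .
  have "R2 w = gen_poly (length w) (\<lambda>i j k l. card {Z \<in> chain_orders w [1, m - 1, 2, m].
      ?c Z (m - 1) 2 = i \<and> ?c Z m 1 = j \<and> ?c Z 1 (m - 1) = k \<and> ?c Z 2 m = l})"
    \<comment> \<open>\<open>conj_ac\<close> compensates for the permuted list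
      \<open>[i, l, j, k]\<close>: the four conditions are brought into the order of the
      variables.\<close>
    by (simp only: R2_def g2_def[abs_def] RR2_def Let_def m[symmetric] gap_counts_4 list.inject simp_thms conj_ac)
  also have "\<dots> = (\<Sum>p\<in>word_positions w. weight2 m (p 2) (p (m - 1)) (p m))"
  proof (rule gen_poly_chain_orders[OF m])
    show "{m - 1, 2, m} \<subseteq> {2..m}" using mem by simp
  qed (simp_all add: m4 count weight2_def)
  finally show "R2 w = (\<Sum>p\<in>word_positions w. weight2 m (p 2) (p (m - 1)) (p m))" .
  have "R3 w = gen_poly (length w) (\<lambda>i j k l. card {Z \<in> chain_orders w [1, m - 1, m, 2].
      ?c Z m 2 = i \<and> ?c Z 2 1 = j \<and> ?c Z 1 (m - 1) = k \<and> ?c Z (m - 1) m = l})"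
    by (simp only: R3_def g3_def[abs_def] RR3_def Let_def m[symmetric] gap_counts_4 list.inject simp_thms)
  also have "\<dots> = (\<Sum>p\<in>word_positions w. weight3 m (p 2) (p (m - 1)) (p m))"
  proof (rule gen_poly_chain_orders[OF m])
    show "{m - 1, m, 2} \<subseteq> {2..m}" using mem by simp
  qed (simp_all add: m4 count weight3_def)
  finally show "R3 w = (\<Sum>p\<in>word_positions w. weight3 m (p 2) (p (m - 1)) (p m))" .
  have "R4 w = gen_poly (length w) (\<lambda>i j k l. card {Z \<in> chain_orders w [1, 2, m, m - 1].
      ?c Z m (m - 1) = i \<and> ?c Z (m - 1) 1 = j \<and> ?c Z 1 2 = k \<and> ?c Z 2 m = l})"
    by (simp only: R4_def g4_def[abs_def] RR4_def Let_def m[symmetric] gap_counts_4 list.inject simp_thms)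
  also have "\<dots> = (\<Sum>p\<in>word_positions w. weight4 m (p 2) (p (m - 1)) (p m))"
  proof (rule gen_poly_chain_orders[OF m])
    show "{2, m, m - 1} \<subseteq> {2..m}" using mem by simp
  qed (simp_all add: m4 count weight4_def)
  finally show "R4 w = (\<Sum>p\<in>word_positions w. weight4 m (p 2) (p (m - 1)) (p m))" .
  have "R5 w = gen_poly (length w) (\<lambda>i j k l. card {Z \<in> chain_orders w [1, m, 2, m - 1].
      ?c Z m 2 = i \<and> ?c Z (m - 1) 1 = j \<and> ?c Z 1 m = k \<and> ?c Z 2 (m - 1) = l})"
    by (simp only: R5_def g5_def[abs_def] RR5_def Let_def m[symmetric] gap_counts_4 list.inject simp_thms conj_ac)
  also have "\<dots> = (\<Sum>p\<in>word_positions w. weight5 m (p 2) (p (m - 1)) (p m))"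
  proof (rule gen_poly_chain_orders[OF m])
    show "{m, 2, m - 1} \<subseteq> {2..m}" using mem by simp
  qed (simp_all add: m4 count weight5_def)
  finally show "R5 w = (\<Sum>p\<in>word_positions w. weight5 m (p 2) (p (m - 1)) (p m))" .
  have "R6 w = gen_poly (length w) (\<lambda>i j k l. card {Z \<in> chain_orders w [1, m, m - 1, 2].
      ?c Z (m - 1) 2 = i \<and> ?c Z 2 1 = j \<and> ?c Z 1 m = k \<and> ?c Z m (m - 1) = l})"
    by (simp only: R6_def g6_def[abs_def] RR6_def Let_def m[symmetric] gap_counts_4 list.inject simp_thms)
  also have "\<dots> = (\<Sum>p\<in>word_positions w. weight6 m (p 2) (p (m - 1)) (p m))"
  proof (rule gen_poly_chain_orders[OF m])
    show "{m, m - 1, 2} \<subseteq> {2..m}" using mem by simp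
  qed (simp_all add: m4 count weight6_def)
  finally show "R6 w = (\<Sum>p\<in>word_positions w. weight6 m (p 2) (p (m - 1)) (p m))" .
qed

section \<open>Assembling the recurrences\<close>

lemma sum_insertions:
  assumes "m = length w + 2"
  shows "(\<Sum>q\<in>word_positions (w @ [s]). W (m + 1) (q 2) (q m) (q (m + 1))) =
    (\<Sum>p\<in>word_positions w. insertion_sum s W m (p 2) (p (m - 1)) (p m))"
  unfolding insertion_sum_def by (rule sum_word_positions_snoc[OF assms])

theorem theorem4:
  fixes n :: nat and w :: "sign list"
  assumes "n \<ge> 2" and "length w = n"
  shows
    "R1 (w @ [Plus]) = Phi 4 1 2 (R1 w) + Phi 3 1 2 (R2 w) + Phi 2 2 1 (R4 w) \<and>
     R2 (w @ [Plus]) = Phi 3 4 2 (R3 w) + Phi 2 2 4 (R5 w) \<and>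
     R3 (w @ [Plus]) = Phi 3 4 1 (R3 w) + Phi 2 4 1 (R5 w) + Phi 1 1 4 (R6 w) \<and>
     R4 (w @ [Plus]) = Phi 1 1 4 (R1 w) \<and>
     R5 (w @ [Plus]) = Phi 4 1 3 (R1 w) + Phi 1 1 3 (R2 w) \<and>
     R6 (w @ [Plus]) = Phi 4 4 3 (R3 w) \<and>
     R1 (w @ [Minus]) = Phi 1 1 2 (R4 w) \<and>
     R2 (w @ [Minus]) = Phi 1 4 2 (R6 w) + Phi 4 4 2 (R5 w) \<and>
     R3 (w @ [Minus]) = Phi 4 4 1 (R6 w) \<and>
     R4 (w @ [Minus]) = Phi 2 1 4 (R4 w) + Phi 3 1 4 (R2 w) + Phi 4 4 1 (R1 w) \<and>
     R5 (w @ [Minus]) = Phi 2 1 3 (R4 w) + Phi 3 3 1 (R2 w) \<and>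
     R6 (w @ [Minus]) = Phi 1 4 3 (R6 w) + Phi 2 4 3 (R5 w) + Phi 3 3 4 (R3 w)"
proof -
  define m where "m = length w + 2"
  have len: "length w \<ge> 2" using assms by simp
  have R_w: "R1 w = (\<Sum>p\<in>word_positions w. weight1 m (p 2) (p (m - 1)) (p m))"
    "R2 w = (\<Sum>p\<in>word_positions w. weight2 m (p 2) (p (m - 1)) (p m))"
    "R3 w = (\<Sum>p\<in>word_positions w. weight3 m (p 2) (p (m - 1)) (p m))"
    "R4 w = (\<Sum>p\<in>word_positions w. weight4 m (p 2) (p (m - 1)) (p m))"
    "R5 w = (\<Sum>p\<in>word_positions w. weight5 m (p 2) (p (m - 1)) (p m))"
    "R6 w = (\<Sum>p\<in>word_positions w. weight6 m (p 2) (p (m - 1)) (p m))"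
    by (rule R1_eq_sum R2_eq_sum R3_eq_sum R4_eq_sum R5_eq_sum R6_eq_sum, rule len, rule m_def)+
  have len': "length (w @ [s]) \<ge> 2" and m': "m + 1 = length (w @ [s]) + 2" for s
    using len m_def by simp_all
  have R_snoc: 
    "R1 (w @ [s]) = (\<Sum>p\<in>word_positions w. insertion_sum s weight1 m (p 2) (p (m - 1)) (p m))"
    "R2 (w @ [s]) = (\<Sum>p\<in>word_positions w. insertion_sum s weight2 m (p 2) (p (m - 1)) (p m))"
    "R3 (w @ [s]) = (\<Sum>p\<in>word_positions w. insertion_sum s weight3 m (p 2) (p (m - 1)) (p m))"
    "R4 (w @ [s]) = (\<Sum>p\<in>word_positions w. insertion_sum s weight4 m (p 2) (p (m - 1)) (p m))"
    "R5 (w @ [s]) = (\<Sum>p\<in>word_positions w. insertion_sum s weight5 m (p 2) (p (m - 1)) (p m))"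
    "R6 (w @ [s]) = (\<Sum>p\<in>word_positions w. insertion_sum s weight6 m (p 2) (p (m - 1)) (p m))"
    for s
    using R1_eq_sum[OF len' m', of s] R2_eq_sum[OF len' m', of s] R3_eq_sum[OF len' m', of s]
      R4_eq_sum[OF len' m', of s] R5_eq_sum[OF len' m', of s] R6_eq_sum[OF len' m', of s]
    \<comment> \<open>For the longer word the last but one element appears as
      \<open>m + 1 - 1\<close>, which must become \<open>m\<close> before the insertion formula
      applies.\<close>
    by (simp_all only: sum_insertions[OF m_def] add_diff_cancel_right')
  have "insertion_rules m (p 2) (p (m - 1)) (p m)" if "p \<in> word_positions w" for p
  proof (rule insertion_rules)
    have p: "p \<in> positions m" using that by (simp add: word_positions_def m_def)
    have mem: "2 \<in> {2..m}" "m - 1 \<in> {2..m}" "m \<in> {2..m}" and ne: "2 \<noteq> m - 1" "2 \<noteq> m" "m - 1 \<noteq> m"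
      using len by (auto simp: m_def)
    have inj: "inj_on p {2..m}"
      using p by (auto simp: positions_def intro: inj_on_subset)
    show "distinct [p 2, p (m - 1), p m]"
      using inj_on_eq_iff[OF inj mem(1,2)] inj_on_eq_iff[OF inj mem(1,3)] inj_on_eq_iff[OF inj mem(2,3)] ne
      by simp
    show "{p 2, p (m - 1), p m} \<subseteq> {1..<m}"
      using positions_pos[OF p mem(1)] positions_pos[OF p mem(2)] positions_pos[OF p mem(3)] by simp
  qed
  note rules = this[unfolded insertion_rules_def]
  show ?thesis
    \<comment> \<open>By additivity of \<open>Phi\<close> both sides are sums over the same position
      functions, so the recurrences hold summand by summand.\<close>
    unfolding R_snoc R_w Phi_sum[OF finite_word_positions] sum.distrib[symmetric]
    by (intro conjI; intro sum.cong refl; use rules in simp)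
qed

end
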